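(* Let $\mathcal{C}$ be a covariety and $S\in\mathcal{C}$. Then the set of children of $S$ in the tree $G(\mathcal{C})$ is $$\{S\cup\{x\}\mid x\in SG(S),\ x<m(S)\ \text{and}\ S\cup\{x\}\in\mathcal{C}\}.$$
   Context: Let $\mathbb{N}=\{0,1,2,\dots\}$. A numerical semigroup is a subset $S\subseteq\mathbb{N}$ that contains $0$, is closed under addition, and has finite complement $\mathbb{N}\setminus S$. Its multiplicity is $m(S)=\min(S\setminus\{0\})$. A covariety is a nonempty family $\mathcal{C}$ of numerical semigroups such that: (1) $\mathcal{C}$ has a minimum $\Delta(\mathcal{C})=\min(\mathcal{C})$ with respect to set inclusion; (2) if $S,T\in\mathcal{C}$ then $S\cap T\in\mathcal{C}$; (3) if $S\in\mathcal{C}$ and $S\neq\Delta(\mathcal{C})$ then $S\setminus\{m(S)\}\in\mathcal{C}$. The directed graph $G(\mathcal{C})$ has vertex set $\mathcal{C}$, and $(S,T)\in\mathcal{C}\times\mathcal{C}$ is an edge if and only if $T=S\setminus\{m(S)\}$; it is a tree with root $\Delta(\mathcal{C})$. If $(u,v)$ is an edge, $u$ is called a child of $v$. The set of pseudo-Frobenius numbers of $S$ is $PF(S)=\{z\in\mathbb{Z}\mid z\notin S,\ z+s\in S\text{ for all }s\in S\setminus\{0\}\}$, and the set of special gaps of $S$ is $SG(S)=\{x\in PF(S)\mid 2x\in S\}$. *)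

theory Defs
  imports Main "Graph_Theory.Pair_Digraph"
begin

definition numerical_semigroup :: "nat set \<Rightarrow> bool" where
  "numerical_semigroup S \<longleftrightarrow>
     0 \<in> S \<and> (\<forall>x\<in>S. \<forall>y\<in>S. x + y \<in> S) \<and> finite (UNIV - S)"

definition multiplicity :: "nat set \<Rightarrow> nat" where
  "multiplicity S = (LEAST n. n \<in> S - {0})"

text \<open>The order on sets is inclusion, so this is the minimum of \<open>C\<close> whenever there is one.\<close>

definition min_family :: "nat set set \<Rightarrow> nat set" where
  "min_family C = (LEAST D. D \<in> C)"

definition covariety :: "nat set set \<Rightarrow> bool" where
  "covariety C \<longleftrightarrow>
     C \<noteq> {} \<and>
     (\<forall>S\<in>C. numerical_semigroup S) \<and>
     (\<exists>D\<in>C. \<forall>T\<in>C. D \<subseteq> T) \<and>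
     (\<forall>S\<in>C. \<forall>T\<in>C. S \<inter> T \<in> C) \<and>
     (\<forall>S\<in>C. S \<noteq> min_family C \<longrightarrow> S - {multiplicity S} \<in> C)"

definition covariety_graph :: "nat set set \<Rightarrow> nat set pair_pre_digraph" where
  "covariety_graph C =
     \<lparr>pverts = C, parcs = {(S, T). (S, T) \<in> C \<times> C \<and> T = S - {multiplicity S}}\<rparr>"

text \<open>Edges point towards the root, so the children of \<open>v\<close> are the tails of the edges into \<open>v\<close>.\<close>

definition children :: "'a pair_pre_digraph \<Rightarrow> 'a \<Rightarrow> 'a set" where
  "children G v = {u. (u, v) \<in> parcs G}"

text \<open>Pseudo-Frobenius numbers are integers and may be negative: \<open>PF UNIV = {-1}\<close>.\<close>

definition PF :: "nat set \<Rightarrow> int set" where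
  "PF S = {z. z \<notin> int ` S \<and> (\<forall>s\<in>S - {0}. z + int s \<in> int ` S)}"

definition SG :: "nat set \<Rightarrow> int set" where
  "SG S = {x \<in> PF S. 2 * x \<in> int ` S}"

text \<open>Special gaps are nonnegative, so viewing them as natural numbers through \<open>nat\<close>
  loses nothing.\<close>

lemma SG_nonneg: "x \<in> SG S \<Longrightarrow> 0 \<le> x"
  by (auto simp: SG_def)

end

theory Submission
  imports Defs
begin

text \<open>A child of \<open>S\<close> is a \<open>T\<close> in \<open>C\<close> with
  \<open>T - {multiplicity T} = S\<close>, so \<open>T\<close> is \<open>S\<close> with the single
  element \<open>multiplicity T\<close> restored. This element is a special gap of \<open>S\<close>:
  its sums with nonzero elements of \<open>T\<close>, itself included, lie in \<open>T\<close> and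
  differ from it, hence lie in \<open>S\<close> (\<open>multiplicity_mem_SG_Diff\<close>). It is
  below \<open>multiplicity S\<close> by minimality (\<open>multiplicity_less_Diff\<close>).
  Conversely, a special gap below \<open>multiplicity S\<close> is positive and becomes the
  multiplicity once adjoined (\<open>multiplicity_insert_less\<close>), so deleting the multiplicity
  gives back \<open>S\<close>.\<close>

lemma int_mem_SG_iff:
  "int n \<in> SG S \<longleftrightarrow> n \<notin> S \<and> (\<forall>s\<in>S - {0}. n + s \<in> S) \<and> 2 * n \<in> S"
proof -
  have "2 * int n = int (2 * n)" "\<And>s. int n + int s = int (n + s)"
    by simp_all
  then show ?thesis
    unfolding SG_def PF_def by (simp only: mem_Collect_eq inj_image_mem_iff[OF inj_of_nat]) auto
qed

text \<open>Otherwise both \<open>S\<close> and its complement would be finite. This makes the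
  \<open>LEAST\<close> in \<open>multiplicity\<close> an attained minimum.\<close>

lemma numerical_semigroup_nontrivial:
  assumes "numerical_semigroup S"
  shows "S - {0} \<noteq> {}"
proof
  assume "S - {0} = {}"
  then have "finite S"
    by (metis finite.emptyI finite_insert finite_Diff2)
  moreover have "finite (UNIV - S)"
    using assms by (simp add: numerical_semigroup_def)
  ultimately show False
    by (metis Diff_infinite_finite infinite_UNIV_nat)
qed

lemma multiplicity_mem:
  assumes "numerical_semigroup S"
  shows "multiplicity S \<in> S - {0}"
  unfolding multiplicity_def using numerical_semigroup_nontrivial[OF assms]
  by (metis LeastI ex_in_conv)

lemma multiplicity_le: "s \<in> S - {0} \<Longrightarrow> multiplicity S \<le> s"
  unfolding multiplicity_def by (rule Least_le)

lemma multiplicity_insert_less: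
  assumes "0 < n" and "n < multiplicity S"
  shows "multiplicity (S \<union> {n}) = n"
  unfolding multiplicity_def
proof (rule Least_equality)
  show "n \<in> S \<union> {n} - {0}"
    using assms(1) by simp
  show "n \<le> s" if "s \<in> S \<union> {n} - {0}" for s
    using that multiplicity_le[of s S] assms(2) by fastforce
qed

text \<open>With m the multiplicity, closure puts m + s and 2m in \<open>T\<close>; neither equals m
  because s and m are nonzero, so both survive the deletion of m.\<close>

lemma multiplicity_mem_SG_Diff:
  assumes "numerical_semigroup T"
  shows "int (multiplicity T) \<in> SG (T - {multiplicity T})"
  using multiplicity_mem[OF assms] assms
  by (auto simp: int_mem_SG_iff numerical_semigroup_def mult_2)

text \<open>The multiplicity of the smaller set is a nonzero element of \<open>T\<close> other than
  \<open>multiplicity T\<close>, which bounds all such elements from below.\<close>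

lemma multiplicity_less_Diff:
  assumes "numerical_semigroup (T - {multiplicity T})"
  shows "multiplicity T < multiplicity (T - {multiplicity T})"
proof -
  have "multiplicity (T - {multiplicity T}) \<in> T - {multiplicity T} - {0}"
    using multiplicity_mem[OF assms] .
  then show ?thesis
    using multiplicity_le[of "multiplicity (T - {multiplicity T})" T] by force
qed

theorem proposition2p9:
  fixes C :: "nat set set" and S :: "nat set"
  assumes "covariety C" and "S \<in> C"
  shows "children (covariety_graph C) S =
    {S \<union> {nat x} | x. x \<in> SG S \<and> x < int (multiplicity S) \<and> S \<union> {nat x} \<in> C}"
proof -
  have semigroup: "numerical_semigroup T" if "T \<in> C" for T
    using assms(1) that by (simp add: covariety_def)
  have children: "T \<in> children (covariety_graph C) S \<longleftrightarrow>
      T \<in> C \<and> S = T - {multiplicity T}" for T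
    using assms(2) by (auto simp: children_def covariety_graph_def)
  show ?thesis
  proof (intro set_eqI iffI)
    fix T
    assume "T \<in> children (covariety_graph C) S"
    then have T: "T \<in> C" "S = T - {multiplicity T}"
      by (simp_all add: children)
    \<comment> \<open>Written with \<open>nat (int _)\<close> so that
      \<open>int (multiplicity T)\<close> is visibly the witness for \<open>x\<close>.\<close>
    then have "T = S \<union> {nat (int (multiplicity T))}"
      using multiplicity_mem[OF semigroup] by auto
    moreover have "int (multiplicity T) \<in> SG S"
      using multiplicity_mem_SG_Diff[OF semigroup] T by simp
    moreover have "int (multiplicity T) < int (multiplicity S)"
      using multiplicity_less_Diff[of T] semigroup[OF assms(2)] T(2) by simp
    ultimately show "T \<in> {S \<union> {nat x} | x.
        x \<in> SG S \<and> x < int (multiplicity S) \<and> S \<union> {nat x} \<in> C}"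
      using T(1) by (metis (mono_tags, lifting) mem_Collect_eq)
  next
    fix T
    assume "T \<in> {S \<union> {nat x} | x.
        x \<in> SG S \<and> x < int (multiplicity S) \<and> S \<union> {nat x} \<in> C}"
    then obtain x where x: "x \<in> SG S" "x < int (multiplicity S)" "T = S \<union> {nat x}" "T \<in> C"
      by blast
    define n where "n = nat x"
    \<comment> \<open>\<open>nat\<close> sends negative integers to 0, so nonnegativity of special
      gaps is what makes this hold.\<close>
    have "x = int n"
      using SG_nonneg[OF x(1)] by (simp add: n_def)
    then have n: "n \<notin> S" "n < multiplicity S" "T = S \<union> {n}"
      using x by (simp_all add: int_mem_SG_iff)
    \<comment> \<open>The gap cannot be 0, since 0 belongs to every numerical semigroup.\<close>
    moreover have "0 < n"
      using n(1) semigroup[OF assms(2)] by (metis gr0I numerical_semigroup_def)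
    ultimately have "multiplicity T = n"
      by (simp only: multiplicity_insert_less)
    then show "T \<in> children (covariety_graph C) S"
      using n x(4) by (simp add: children)
  qed
qed

end
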